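(* Let $K\ge 2$, $p\ge 1$ and $d=\min(p,K-1)$. Consider the EDDA Gaussian mixture model with different full class covariance matrices (VVV): class $k$ ($k=1,\dots,K$) has prior probability $\pi_k>0$, $\sum_{k=1}^K\pi_k=1$, and a single Gaussian component with mean $\mu_k\in\mathbb{R}^p$ and an arbitrary symmetric positive definite $p\times p$ covariance matrix $\Sigma_k$. Let $$\mu=\sum_{k=1}^K\pi_k\mu_k,\quad \Sigma_B=\sum_{k=1}^K\pi_k(\mu_k-\mu)(\mu_k-\mu)^\top,\quad \Sigma_W=\sum_{k=1}^K\pi_k\Sigma_k,\quad \Sigma_X=\Sigma_B+\Sigma_W,$$ $$M_{\mathsf I}=\Sigma_B,\qquad M_{\mathsf{II}}=\sum_{k=1}^K\pi_k(\Sigma_k-\Sigma_W)\Sigma_X^{-1}(\Sigma_k-\Sigma_W)^\top,\qquad M=M_{\mathsf I}\Sigma_X^{-1}M_{\mathsf I}+M_{\mathsf{II}}.$$ Then the subspace $\mathcal S(\beta)$ spanned by the columns of the solution $\beta\in\mathbb{R}^{p\times d}$ of the GMMDRC problem $$\arg\max_\beta\ \beta^\top M\beta\quad\text{subject to}\quad\beta^\top\Sigma_X\beta=I_d$$ is identical to the subspace $\mathcal S(\beta^{\mathsf{SAVE}})$ spanned by SAVE. That is, a $d$-dimensional subspace of $\mathbb{R}^p$ is the span of a GMMDRC solution if and only if it is the span of a choice of $d$ leading SAVE directions.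
   Context: A solution of the GMMDRC (Gaussian mixture model dimension reduction for classification) problem means a matrix $\beta=(\beta_1,\dots,\beta_d)$ given by the generalized eigen-decomposition of $M$ with respect to $\Sigma_X$: $M\beta_j=l_j\Sigma_X\beta_j$ for $j=1,\dots,d$, $\beta^\top\Sigma_X\beta=I_d$, and $l_1\ge\dots\ge l_d$ are the $d$ largest generalized eigenvalues counted with multiplicity. $\mathcal S(\beta)$ denotes the column span of $\beta$. SAVE (sliced average variance estimation, categorical response) has kernel matrix $$M_{\mathsf{SAVE}}=\sum_{k=1}^K\pi_k\left(I_p-\Sigma_X^{-1/2}\Sigma_k\Sigma_X^{-1/2}\right)^2,$$ where $\Sigma_X^{-1/2}$ is the symmetric positive definite inverse square root of $\Sigma_X$. The SAVE directions are $\beta_j^{\mathsf{SAVE}}=\Sigma_X^{-1/2}v_j$, $j=1,\dots,d$, where $v_1,\dots,v_d$ are orthonormal eigenvectors of $M_{\mathsf{SAVE}}$ associated with its $d$ largest eigenvalues counted with multiplicity. *)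

theory Defs
  imports "HOL-Analysis.Analysis" "HOL-Computational_Algebra.Polynomial"
begin

definition sym_pos_def :: "real^'p^'p \<Rightarrow> bool" where
  "sym_pos_def A \<longleftrightarrow> transpose A = A \<and> (\<forall>x. x \<noteq> 0 \<longrightarrow> 0 < x \<bullet> (A *v x))"

definition outer_square :: "real^'p \<Rightarrow> real^'p^'p" where
  "outer_square x = (\<chi> i j. x $ i * x $ j)"

definition inv_sqrt :: "real^'p^'p \<Rightarrow> real^'p^'p" where
  "inv_sqrt A = (THE R. sym_pos_def R \<and> R ** R = matrix_inv A)"

text \<open>
  The generalized eigenvalues of \<open>A\<close> with respect to \<open>S\<close> (the \<open>l\<close> with
  \<open>A v = l S v\<close> for some \<open>v \<noteq> 0\<close>), counted with multiplicity as roots of \<open>det (l S - A)\<close>.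
  This is the intended multiset when \<open>A\<close> is symmetric and \<open>S\<close> is symmetric positive definite:
  all \<open>CARD('p)\<close> roots are then real.
\<close>

definition gen_eigenvalues :: "real^'p^'p \<Rightarrow> real^'p^'p \<Rightarrow> real multiset" where
  "gen_eigenvalues A S = proots (det (\<chi> i j. [:- (A $ i $ j), S $ i $ j:]))"

text \<open>The \<open>j\<close>-th largest one, counted from \<open>j = 1\<close>; meaningful for \<open>1 \<le> j \<le> CARD('p)\<close>.\<close>

definition nth_gen_eigenvalue :: "real^'p^'p \<Rightarrow> real^'p^'p \<Rightarrow> nat \<Rightarrow> real" where
  "nth_gen_eigenvalue A S j = rev (sorted_list_of_multiset (gen_eigenvalues A S)) ! (j - 1)"

definition nth_eigenvalue :: "real^'p^'p \<Rightarrow> nat \<Rightarrow> real" where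
  "nth_eigenvalue A j = nth_gen_eigenvalue A (mat 1) j"

text \<open>
  The classes are \<open>k \<in> {1..K}\<close>, with prior \<open>\<pi> k\<close>, mean \<open>\<mu> k\<close> and covariance matrix \<open>C k\<close>.
\<close>

definition overall_mean :: "nat \<Rightarrow> (nat \<Rightarrow> real) \<Rightarrow> (nat \<Rightarrow> real^'p) \<Rightarrow> real^'p" where
  "overall_mean K \<pi> \<mu> = (\<Sum>k=1..K. \<pi> k *\<^sub>R \<mu> k)"

definition Sigma_B :: "nat \<Rightarrow> (nat \<Rightarrow> real) \<Rightarrow> (nat \<Rightarrow> real^'p) \<Rightarrow> real^'p^'p" where
  "Sigma_B K \<pi> \<mu> = (\<Sum>k=1..K. \<pi> k *\<^sub>R outer_square (\<mu> k - overall_mean K \<pi> \<mu>))"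

definition Sigma_W :: "nat \<Rightarrow> (nat \<Rightarrow> real) \<Rightarrow> (nat \<Rightarrow> real^'p^'p) \<Rightarrow> real^'p^'p" where
  "Sigma_W K \<pi> C = (\<Sum>k=1..K. \<pi> k *\<^sub>R C k)"

definition Sigma_X ::
  "nat \<Rightarrow> (nat \<Rightarrow> real) \<Rightarrow> (nat \<Rightarrow> real^'p) \<Rightarrow> (nat \<Rightarrow> real^'p^'p) \<Rightarrow> real^'p^'p" where
  "Sigma_X K \<pi> \<mu> C = Sigma_B K \<pi> \<mu> + Sigma_W K \<pi> C"

definition M_I :: "nat \<Rightarrow> (nat \<Rightarrow> real) \<Rightarrow> (nat \<Rightarrow> real^'p) \<Rightarrow> real^'p^'p" where
  "M_I K \<pi> \<mu> = Sigma_B K \<pi> \<mu>"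

definition M_II ::
  "nat \<Rightarrow> (nat \<Rightarrow> real) \<Rightarrow> (nat \<Rightarrow> real^'p) \<Rightarrow> (nat \<Rightarrow> real^'p^'p) \<Rightarrow> real^'p^'p" where
  "M_II K \<pi> \<mu> C =
    (\<Sum>k=1..K. \<pi> k *\<^sub>R ((C k - Sigma_W K \<pi> C) ** matrix_inv (Sigma_X K \<pi> \<mu> C)
                        ** transpose (C k - Sigma_W K \<pi> C)))"

definition M_GMMDRC ::
  "nat \<Rightarrow> (nat \<Rightarrow> real) \<Rightarrow> (nat \<Rightarrow> real^'p) \<Rightarrow> (nat \<Rightarrow> real^'p^'p) \<Rightarrow> real^'p^'p" where
  "M_GMMDRC K \<pi> \<mu> C =
    M_I K \<pi> \<mu> ** matrix_inv (Sigma_X K \<pi> \<mu> C) ** M_I K \<pi> \<mu> + M_II K \<pi> \<mu> C"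

text \<open>
  A \<open>p \<times> d\<close> matrix \<open>\<beta>\<close> is given by its columns \<open>\<beta> 1, \<dots>, \<beta> d\<close>. The second conjunct
  is \<open>\<beta>\<^sup>T S \<beta> = I\<close>, entry by entry.
\<close>

definition gen_eigen_solution :: "real^'p^'p \<Rightarrow> real^'p^'p \<Rightarrow> nat \<Rightarrow> (nat \<Rightarrow> real^'p) \<Rightarrow> bool" where
  "gen_eigen_solution A S d \<beta> \<longleftrightarrow>
     (\<forall>j\<in>{1..d}. A *v \<beta> j = nth_gen_eigenvalue A S j *\<^sub>R (S *v \<beta> j)) \<and>
     (\<forall>i\<in>{1..d}. \<forall>j\<in>{1..d}. \<beta> i \<bullet> (S *v \<beta> j) = (if i = j then 1 else 0))"

definition gmmdrc_solution ::
  "nat \<Rightarrow> (nat \<Rightarrow> real) \<Rightarrow> (nat \<Rightarrow> real^'p) \<Rightarrow> (nat \<Rightarrow> real^'p^'p) \<Rightarrow> nat \<Rightarrow> (nat \<Rightarrow> real^'p) \<Rightarrow> bool"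
where
  "gmmdrc_solution K \<pi> \<mu> C d \<beta> \<longleftrightarrow>
     gen_eigen_solution (M_GMMDRC K \<pi> \<mu> C) (Sigma_X K \<pi> \<mu> C) d \<beta>"

definition M_SAVE ::
  "nat \<Rightarrow> (nat \<Rightarrow> real) \<Rightarrow> (nat \<Rightarrow> real^'p) \<Rightarrow> (nat \<Rightarrow> real^'p^'p) \<Rightarrow> real^'p^'p" where
  "M_SAVE K \<pi> \<mu> C =
    (let R = inv_sqrt (Sigma_X K \<pi> \<mu> C)
     in \<Sum>k=1..K. \<pi> k *\<^sub>R ((mat 1 - R ** C k ** R) ** (mat 1 - R ** C k ** R)))"

definition save_directions ::
  "nat \<Rightarrow> (nat \<Rightarrow> real) \<Rightarrow> (nat \<Rightarrow> real^'p) \<Rightarrow> (nat \<Rightarrow> real^'p^'p) \<Rightarrow> nat \<Rightarrow> (nat \<Rightarrow> real^'p) \<Rightarrow> bool"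
where
  "save_directions K \<pi> \<mu> C d \<beta> \<longleftrightarrow>
     (\<exists>v. (\<forall>j\<in>{1..d}. M_SAVE K \<pi> \<mu> C *v v j = nth_eigenvalue (M_SAVE K \<pi> \<mu> C) j *\<^sub>R v j) \<and>
          (\<forall>i\<in>{1..d}. \<forall>j\<in>{1..d}. v i \<bullet> v j = (if i = j then 1 else 0)) \<and>
          (\<forall>j\<in>{1..d}. \<beta> j = inv_sqrt (Sigma_X K \<pi> \<mu> C) *v v j))"

definition column_span :: "nat \<Rightarrow> (nat \<Rightarrow> real^'p) \<Rightarrow> (real^'p) set" where
  "column_span d \<beta> = span (\<beta> ` {1..d})"

end

theory Submission
  imports Defs
begin

text \<open>
  Write \<open>S = \<Sigma>\<^sub>X\<close> and \<open>R = S\<^sup>-\<^sup>1\<^sup>/\<^sup>2\<close>. Since \<open>I - R \<Sigma>\<^sub>k R = R (S - \<Sigma>\<^sub>k) R\<close> and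
  \<open>S - \<Sigma>\<^sub>k = \<Sigma>\<^sub>B - (\<Sigma>\<^sub>k - \<Sigma>\<^sub>W)\<close>, where the deviations \<open>\<Sigma>\<^sub>k - \<Sigma>\<^sub>W\<close> have weighted sum zero, expanding
  the square gives \<open>M\<^sub>S\<^sub>A\<^sub>V\<^sub>E = R M R\<close>. Substituting \<open>\<beta> = R v\<close> turns the generalized
  eigenproblem of \<open>M\<close> with respect to \<open>S\<close> into the ordinary one of \<open>R M R\<close>, with
  the same eigenvalues because \<open>det (l I - R M R) = (det R)\<^sup>2 det (l S - M)\<close>. Hence the solutions
  themselves coincide, not only their spans.
\<close>

section \<open>The spectral theorem\<close>

text \<open>Maximize the Rayleigh quotient over the unit sphere of \<open>W\<close>, which is
  compact. At a maximizer \<open>u\<close> with value \<open>a\<close>, the residual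
  \<open>a u - f u\<close> must vanish, since otherwise moving \<open>u\<close> along it would
  increase the quotient.\<close>

lemma self_adjoint_eigenvector_exists:
  fixes f :: "'a::euclidean_space \<Rightarrow> 'a"
  assumes f: "linear f" and adj: "\<And>x y. f x \<bullet> y = x \<bullet> f y"
    and W: "subspace W" and inv: "f ` W \<subseteq> W" and nz: "W \<noteq> {0}"
  shows "\<exists>u\<in>W. norm u = 1 \<and> (\<exists>a. f u = a *\<^sub>R u)"
proof -
  interpret f: linear f by fact
  let ?K = "sphere 0 1 \<inter> W"
  have "compact ?K"
    using closed_subspace[OF W] by (intro compact_Int_closed) auto
  moreover obtain w where w: "w \<in> W" "w \<noteq> 0" using nz subspace_0[OF W] by blast
  then have "w /\<^sub>R norm w \<in> ?K" using subspace_scale[OF W] by simp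
  then have "?K \<noteq> {}" by blast
  moreover have "continuous_on ?K (\<lambda>x. x \<bullet> f x)"
    using f by (intro continuous_intros linear_continuous_on linear_conv_bounded_linear[THEN iffD1])
  ultimately obtain u where u: "u \<in> ?K" and max: "\<And>x. x \<in> ?K \<Longrightarrow> x \<bullet> f x \<le> u \<bullet> f u"
    using continuous_attains_sup by metis
  define a where "a = u \<bullet> f u"
  define g where "g x = a * (x \<bullet> x) - x \<bullet> f x" for x
  \<comment> \<open>The form \<open>g\<close> is homogeneous of degree two, so maximality of
    \<open>a\<close> on the unit sphere extends to all of \<open>W\<close>.\<close>
  have g_nonneg: "g x \<ge> 0" if "x \<in> W" for x
  proof (cases "x = 0")
    case False
    have "x /\<^sub>R norm x \<in> ?K" using that False subspace_scale[OF W] by simp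
    from max[OF this] have "(x \<bullet> f x) / (norm x)\<^sup>2 \<le> a"
      by (simp add: f.scaleR a_def power2_eq_square divide_simps)
    then show ?thesis using False
      by (simp add: g_def dot_square_norm divide_simps)
  qed (simp add: g_def)
  have uu: "u \<bullet> u = 1" using u by (simp add: dot_square_norm)
  define z where "z = a *\<^sub>R u - f u"
  have zW: "z \<in> W" unfolding z_def using u inv W by (auto intro!: subspace_diff subspace_scale)
  \<comment> \<open>Here \<open>g u = 0\<close>, and by self-adjointness the first-order term of
    \<open>g\<close> at \<open>u\<close> in direction \<open>z\<close> is twice the squared norm of
    \<open>z\<close>.\<close>
  have expand: "g (u + t *\<^sub>R z) = 2 * t * (z \<bullet> z) + t\<^sup>2 * g z" for t
  proof -
    have "z \<bullet> f u = u \<bullet> f z" using adj by (metis inner_commute)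
    moreover have "z \<bullet> z = a * (u \<bullet> z) - z \<bullet> f u"
      unfolding z_def by (simp add: inner_diff inner_commute algebra_simps)
    moreover have "g (u + t *\<^sub>R z) = t * (2 * a * (u \<bullet> z) - z \<bullet> f u - u \<bullet> f z) + t\<^sup>2 * g z"
      by (simp add: g_def f.add f.scaleR inner_add inner_commute[of z u] uu a_def[symmetric]
          power2_eq_square algebra_simps)
    ultimately show ?thesis by simp
  qed
  have "z \<bullet> z = 0"
  proof (rule ccontr)
    assume "z \<bullet> z \<noteq> 0"
    then have p: "z \<bullet> z > 0" by simp
    \<comment> \<open>A small negative step makes the linear term dominate. The \<open>+ 1\<close>
      keeps the denominator positive when \<open>g z = 0\<close>, and this choice turns the
      expansion into \<open>t * (z \<bullet> z) - t\<^sup>2\<close>, which is negative.\<close>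
    define t where "t = - (z \<bullet> z) / (g z + 1)"
    have gz: "g z \<ge> 0" using g_nonneg zW by blast
    have "g (u + t *\<^sub>R z) \<ge> 0"
      using u zW W by (intro g_nonneg subspace_add subspace_scale) auto
    moreover have "2 * t * (z \<bullet> z) + t\<^sup>2 * g z = t * (z \<bullet> z) - t\<^sup>2 + t * (t * (g z + 1) + z \<bullet> z)"
      by (simp add: power2_eq_square algebra_simps)
    moreover have "t < 0" and "t * (g z + 1) + z \<bullet> z = 0"
      using p gz by (simp_all add: t_def)
    moreover have "t * (z \<bullet> z) - t\<^sup>2 < 0"
      using p \<open>t < 0\<close> mult_neg_pos[of t "z \<bullet> z"] zero_le_power2[of t] by linarith
    ultimately show False using expand[of t] by simp
  qed
  then have "f u = a *\<^sub>R u" by (simp add: z_def)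
  then show ?thesis using u by auto
qed

text \<open>Induction on \<open>dim W\<close>: split off a unit eigenvector \<open>u\<close>.
  Self-adjointness makes the orthogonal complement of \<open>u\<close> in \<open>W\<close> invariant
  again, which is why the claim is made for invariant subspaces and not only for the whole
  space.\<close>

lemma self_adjoint_invariant_orthonormal_eigenbasis:
  fixes f :: "'a::euclidean_space \<Rightarrow> 'a"
  assumes f: "linear f" and adj: "\<And>x y. f x \<bullet> y = x \<bullet> f y"
    and "subspace W" and "f ` W \<subseteq> W"
  shows "\<exists>B. finite B \<and> pairwise orthogonal B \<and> (\<forall>b\<in>B. norm b = 1 \<and> (\<exists>a. f b = a *\<^sub>R b)) \<and> span B = W"
  using assms(3,4)
proof (induction "dim W" arbitrary: W rule: less_induct)
  case less
  note W = less.prems(1) and inv = less.prems(2)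
  show ?case
  proof (cases "W = {0}")
    case True
    then show ?thesis by (intro exI[of _ "{}"]) auto
  next
    case False
    obtain u a where u: "u \<in> W" "norm u = 1" "f u = a *\<^sub>R u"
      using self_adjoint_eigenvector_exists[OF f adj W inv False] by blast
    have uu: "u \<bullet> u = 1" using u by (simp add: dot_square_norm)
    define W' where "W' = {x \<in> W. x \<bullet> u = 0}"
    have W': "subspace W'"
      using W by (auto simp: W'_def subspace_def inner_add)
    have "f x \<bullet> u = 0" if "x \<bullet> u = 0" for x
      using that by (simp add: adj u)
    then have inv': "f ` W' \<subseteq> W'" using inv by (auto simp: W'_def)
    have "u \<notin> W'" using uu by (simp add: W'_def)
    then have "W' \<subset> W" using u W'_def by blast
    then have "dim W' < dim W"
      using dim_psubset[of W' W] span_eq_iff[THEN iffD2, OF W] span_eq_iff[THEN iffD2, OF W'] by simp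
    then obtain B where B: "finite B" "pairwise orthogonal B"
        "\<forall>b\<in>B. norm b = 1 \<and> (\<exists>a. f b = a *\<^sub>R b)" "span B = W'"
      using less.hyps[OF _ W' inv'] by blast
    have BW: "B \<subseteq> W'" using B(4) span_superset by blast
    have "span (insert u B) = W"
    proof
      show "span (insert u B) \<subseteq> W"
        using BW u W by (intro span_minimal) (auto simp: W'_def)
    next
      show "W \<subseteq> span (insert u B)"
      proof
        fix x assume x: "x \<in> W"
        \<comment> \<open>Removing the component of \<open>x\<close> along \<open>u\<close> leaves a
          vector of \<open>W'\<close>.\<close>
        have "x - (x \<bullet> u) *\<^sub>R u \<in> span B"
          using x u W uu unfolding B(4) W'_def by (auto simp: inner_diff intro!: subspace_diff subspace_scale)
        then show "x \<in> span (insert u B)" unfolding span_insert by blast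
      qed
    qed
    moreover have "pairwise orthogonal (insert u B)"
      using B(2) BW by (auto simp: pairwise_insert orthogonal_def W'_def inner_commute)
    ultimately show ?thesis using B u by (intro exI[of _ "insert u B"]) auto
  qed
qed

lemma matrix_inner_transpose:
  fixes A :: "real^'m^'n"
  shows "(A *v x) \<bullet> y = x \<bullet> (transpose A *v y)"
  using dot_lmul_matrix[of x "transpose A" y] by simp

lemma symmetric_matrix_orthonormal_eigenbasis:
  fixes A :: "real^'n^'n"
  assumes "transpose A = A"
  shows "\<exists>B a. finite B \<and> pairwise orthogonal B \<and> (\<forall>b\<in>B. norm b = 1 \<and> A *v b = a b *\<^sub>R b) \<and> span B = UNIV"
proof -
  have "\<exists>B. finite B \<and> pairwise orthogonal B \<and> (\<forall>b\<in>B. norm b = 1 \<and> (\<exists>a. A *v b = a *\<^sub>R b)) \<and> span B = UNIV"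
    using assms
    by (intro self_adjoint_invariant_orthonormal_eigenbasis)
       (simp_all add: matrix_inner_transpose del: transpose_matrix_vector)
  then show ?thesis by metis
qed

lemma matrix_eq_on_spanning:
  fixes A B :: "real^'m^'n"
  assumes "span X = UNIV" and "\<And>x. x \<in> X \<Longrightarrow> A *v x = B *v x"
  shows "A = B"
proof -
  have "A *v x = B *v x" for x
    using linear_eq_on_span[of "(*v) A" "(*v) B" X x] assms by simp
  then show ?thesis by (simp add: matrix_eq)
qed

section \<open>Positive definite matrices and their square roots\<close>

lemma outer_square_vector_mult: "outer_square x *v y = (x \<bullet> y) *\<^sub>R x"
  by (simp add: vec_eq_iff outer_square_def matrix_vector_mult_def inner_vec_def sum_distrib_left mult.assoc mult.left_commute mult.commute)

lemma transpose_outer_square [simp]: "transpose (outer_square x) = outer_square x"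
  by (simp add: outer_square_def transpose_def mult.commute)

lemma linear_transpose: "linear (transpose :: real^'m^'n \<Rightarrow> real^'n^'m)"
  by (rule linearI) (simp_all add: transpose_def vec_eq_iff)

lemma linear_matrix_vector_mult_left: "linear (\<lambda>A :: real^'m^'n. A *v x)"
  by (rule linearI) (simp_all add: matrix_vector_mult_add_rdistrib scaleR_matrix_vector_assoc)

lemma sym_pos_def_imp_invertible:
  assumes "sym_pos_def A"
  shows "invertible A"
  using assms unfolding sym_pos_def_def invertible_left_inverse matrix_left_invertible_ker
  by (metis inner_zero_right less_irrefl)

lemma matrix_inv_mult:
  fixes A :: "real^'n^'n"
  assumes "invertible A"
  shows "A ** matrix_inv A = mat 1" "matrix_inv A ** A = mat 1"
proof -
  have "A ** matrix_inv A = mat 1 \<and> matrix_inv A ** A = mat 1"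
    using assms unfolding invertible_def matrix_inv_def by (rule someI_ex)
  then show "A ** matrix_inv A = mat 1" "matrix_inv A ** A = mat 1" by auto
qed

text \<open>Positivity follows from the substitution \<open>x = A y\<close>, which turns the
  quadratic form of the inverse at \<open>x\<close> into that of \<open>A\<close> at
  \<open>y\<close>.\<close>

lemma sym_pos_def_matrix_inv:
  fixes A :: "real^'n^'n"
  assumes A: "sym_pos_def A"
  shows "sym_pos_def (matrix_inv A)"
proof -
  note inv = matrix_inv_mult[OF sym_pos_def_imp_invertible[OF A]]
  have "transpose (matrix_inv A) ** A = mat 1"
    using arg_cong[OF inv(1), of transpose] A by (simp add: matrix_transpose_mul sym_pos_def_def)
  then have sym: "transpose (matrix_inv A) = matrix_inv A"
    by (metis inv(1) matrix_mul_assoc matrix_mul_lid matrix_mul_rid)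
  have "0 < x \<bullet> (matrix_inv A *v x)" if "x \<noteq> 0" for x
  proof -
    define y where "y = matrix_inv A *v x"
    have x: "x = A *v y" by (simp add: y_def matrix_vector_mul_assoc inv)
    then have "y \<noteq> 0" using that by auto
    then show ?thesis using A by (simp add: x[symmetric] y_def[symmetric] sym_pos_def_def) (metis x inner_commute)
  qed
  with sym show ?thesis by (simp add: sym_pos_def_def)
qed

text \<open>Functional calculus: in the spectral decomposition of \<open>A\<close>, replace each
  eigenvalue, positive by definiteness, by its square root.\<close>

lemma sym_pos_def_sqrt_exists:
  fixes A :: "real^'n^'n"
  assumes A: "sym_pos_def A"
  shows "\<exists>R. sym_pos_def R \<and> R ** R = A"
proof -
  obtain B a where B: "finite B" "pairwise orthogonal B"
      "\<forall>b\<in>B. norm b = 1 \<and> A *v b = a b *\<^sub>R b" "span B = UNIV"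
    using symmetric_matrix_orthonormal_eigenbasis A unfolding sym_pos_def_def by metis
  have bb: "b \<bullet> c = (if b = c then 1 else 0)" if "b \<in> B" "c \<in> B" for b c
    using that B by (auto simp: pairwise_def orthogonal_def dot_square_norm)
  have pos: "a b > 0" if "b \<in> B" for b
  proof -
    have "b \<noteq> 0" using B(3) that by force
    then have "0 < b \<bullet> (A *v b)" using A by (simp add: sym_pos_def_def)
    then show ?thesis using B(3) that bb by simp
  qed
  define R where "R = (\<Sum>b\<in>B. sqrt (a b) *\<^sub>R outer_square b)"
  have Rx: "R *v x = (\<Sum>b\<in>B. (sqrt (a b) * (b \<bullet> x)) *\<^sub>R b)" for x
    unfolding R_def
    by (simp add: linear_sum[OF linear_matrix_vector_mult_left] scaleR_matrix_vector_assoc[symmetric]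
        outer_square_vector_mult)
  have Rb: "R *v c = sqrt (a c) *\<^sub>R c" if c: "c \<in> B" for c
  proof -
    have "R *v c = (\<Sum>b\<in>B. if b = c then sqrt (a b) *\<^sub>R b else 0)"
      unfolding Rx using bb c by (intro sum.cong) auto
    then show ?thesis using B(1) c by simp
  qed
  have "transpose R = R"
    unfolding R_def by (simp add: linear_sum[OF linear_transpose] transpose_scalar)
  moreover have "0 < x \<bullet> (R *v x)" if "x \<noteq> 0" for x
  proof -
    \<comment> \<open>A vector orthogonal to all of \<open>B\<close> is orthogonal to the whole
      space, hence to itself.\<close>
    have "\<exists>b\<in>B. b \<bullet> x \<noteq> 0"
    proof (rule ccontr)
      assume "\<not> ?thesis"
      then have "orthogonal x y" if "y \<in> span B" for y
        using that by (intro orthogonal_to_span[of y B]) (auto simp: orthogonal_def inner_commute)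
      then have "orthogonal x x" using B(4) by simp
      then show False using \<open>x \<noteq> 0\<close> by (simp add: orthogonal_self)
    qed
    then obtain b where b: "b \<in> B" "b \<bullet> x \<noteq> 0" by blast
    have "x \<bullet> (R *v x) = (\<Sum>b\<in>B. sqrt (a b) * (b \<bullet> x)\<^sup>2)"
      unfolding Rx by (simp add: inner_sum_right power2_eq_square inner_commute mult.assoc)
    also have "\<dots> > 0"
      using b pos by (intro sum_pos2[OF B(1) b(1)]) (simp_all add: less_imp_le)
    finally show ?thesis .
  qed
  moreover have "R ** R = A"
    using B(3) pos by (intro matrix_eq_on_spanning[OF B(4)])
      (auto simp: matrix_vector_mul_assoc[symmetric] Rb matrix_vector_mult_scaleR less_imp_le)
  ultimately show ?thesis by (auto simp: sym_pos_def_def)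
qed

text \<open>
  If \<open>R\<close> has the eigenpair \<open>(a, b)\<close> with \<open>a > 0\<close>, then \<open>(Q + a) (Q - a) b = (Q\<^sup>2 - R\<^sup>2) b = 0\<close>, and
  \<open>Q + a\<close> is injective; so \<open>Q\<close> agrees with \<open>R\<close> on an eigenbasis of \<open>R\<close>.
\<close>

lemma sym_pos_def_sqrt_unique:
  fixes Q R :: "real^'n^'n"
  assumes Q: "sym_pos_def Q" and R: "sym_pos_def R" and eq: "Q ** Q = R ** R"
  shows "Q = R"
proof -
  obtain B a where B: "\<forall>b\<in>B. norm b = 1 \<and> R *v b = a b *\<^sub>R b" "span B = UNIV"
    using symmetric_matrix_orthonormal_eigenbasis R unfolding sym_pos_def_def by metis
  show ?thesis
  proof (rule matrix_eq_on_spanning[OF B(2)])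
    fix b assume b: "b \<in> B"
    have "b \<noteq> 0" using B(1) b by force
    then have "0 < b \<bullet> (R *v b)" using R by (simp add: sym_pos_def_def)
    then have a: "a b > 0" using B(1) b by (simp add: dot_square_norm)
    define z where "z = Q *v b - a b *\<^sub>R b"
    have "Q *v (Q *v b) = R *v (R *v b)" by (simp add: matrix_vector_mul_assoc eq)
    also have "\<dots> = (a b * a b) *\<^sub>R b" using B(1) b by (simp add: matrix_vector_mult_scaleR)
    finally have "Q *v z = - (a b *\<^sub>R z)"
      by (simp add: z_def matrix_vector_mult_diff_distrib matrix_vector_mult_scaleR algebra_simps)
    then have "z \<bullet> (Q *v z) = - (a b * (z \<bullet> z))" by simp
    moreover have "a b * (z \<bullet> z) \<ge> 0" using a by simp
    ultimately have "\<not> 0 < z \<bullet> (Q *v z)" by linarith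
    then have "z = 0" using Q by (auto simp: sym_pos_def_def)
    then show "Q *v b = R *v b" using B(1) b by (simp add: z_def)
  qed
qed

text \<open>Existence and uniqueness of the positive definite square root make the definite
  description in \<open>inv_sqrt\<close> meaningful.\<close>

lemma inv_sqrt:
  fixes A :: "real^'n^'n"
  assumes "sym_pos_def A"
  shows "sym_pos_def (inv_sqrt A)" "inv_sqrt A ** inv_sqrt A = matrix_inv A"
proof -
  have "\<exists>!R. sym_pos_def R \<and> R ** R = matrix_inv A"
    using sym_pos_def_sqrt_exists[OF sym_pos_def_matrix_inv[OF assms]] sym_pos_def_sqrt_unique by metis
  from theI'[OF this] show "sym_pos_def (inv_sqrt A)" "inv_sqrt A ** inv_sqrt A = matrix_inv A"
    by (auto simp: inv_sqrt_def)
qed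

lemma inv_sqrt_congruence:
  fixes A :: "real^'n^'n"
  assumes A: "sym_pos_def A"
  shows "inv_sqrt A ** A ** inv_sqrt A = mat 1"
proof -
  \<comment> \<open>So \<open>inv_sqrt A\<close> is a right inverse of
    \<open>A ** inv_sqrt A\<close>. For square matrices it is then also a left inverse, so there is
    no need to show that \<open>A\<close> commutes with its inverse root.\<close>
  have "(A ** inv_sqrt A) ** inv_sqrt A = mat 1"
    using inv_sqrt(2)[OF A] matrix_inv_mult(1)[OF sym_pos_def_imp_invertible[OF A]]
    by (simp add: matrix_mul_assoc[symmetric])
  then show ?thesis by (metis matrix_left_right_inverse matrix_mul_assoc)
qed

section \<open>Generalized eigenproblems under congruence\<close>

lemma poly_det_pencil:
  fixes A S :: "real^'n^'n"
  shows "poly (det (\<chi> i j. [:- (A $ i $ j), S $ i $ j:])) x = det (x *\<^sub>R S - A)"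
  by (simp add: det_def poly_sum poly_prod)

lemma matrix_diff_ldistrib:
  fixes A :: "real^'m^'n"
  shows "A ** (B - C) = A ** B - A ** C"
  by (simp add: vec_eq_iff matrix_matrix_mult_def algebra_simps sum_subtractf)

lemma matrix_diff_rdistrib:
  fixes A :: "real^'m^'n"
  shows "(A - B) ** C = A ** C - B ** C"
  by (simp add: vec_eq_iff matrix_matrix_mult_def algebra_simps sum_subtractf)

text \<open>Congruence multiplies the characteristic polynomial of the pencil by the nonzero
  constant \<open>(det R)\<^sup>2\<close>. Arguing with polynomials rather than eigenvectors
  preserves multiplicities as well as roots.\<close>

lemma gen_eigenvalues_congruence:
  fixes A S R :: "real^'n^'n"
  assumes "invertible R"
  shows "gen_eigenvalues (transpose R ** A ** R) (transpose R ** S ** R) = gen_eigenvalues A S"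
proof -
  let ?P = "\<lambda>A S :: real^'n^'n. det (\<chi> i j. [:- (A $ i $ j), S $ i $ j:])"
  have "poly (?P (transpose R ** A ** R) (transpose R ** S ** R)) x = poly (smult ((det R)\<^sup>2) (?P A S)) x" for x
  proof -
    have "x *\<^sub>R (transpose R ** S ** R) - transpose R ** A ** R = transpose R ** (x *\<^sub>R S - A) ** R"
      by (simp add: matrix_diff_ldistrib matrix_diff_rdistrib matrix_scalar_ac scalar_matrix_assoc)
    then show ?thesis by (simp add: poly_det_pencil det_mul det_transpose power2_eq_square)
  qed
  then have "?P (transpose R ** A ** R) (transpose R ** S ** R) = smult ((det R)\<^sup>2) (?P A S)"
    \<comment> \<open>Real polynomials that agree at every point are equal.\<close>
    by (intro poly_eq_poly_eq_iff[THEN iffD1] ext)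
  moreover have "det R \<noteq> 0" using assms by (simp add: invertible_det_nz)
  ultimately show ?thesis by (simp add: gen_eigenvalues_def)
qed

text \<open>The outer factor \<open>transpose R\<close> cancels from the eigenvector equation by
  injectivity. In the normalization it moves across the inner product. The ordered eigenvalues are
  the same on both sides.\<close>

lemma gen_eigen_solution_congruence:
  fixes A S R :: "real^'n^'n"
  assumes R: "invertible R"
  shows "gen_eigen_solution (transpose R ** A ** R) (transpose R ** S ** R) d v
         \<longleftrightarrow> gen_eigen_solution A S d (\<lambda>j. R *v v j)"
proof -
  have "invertible (transpose R)" using R by (rule transpose_invertible)
  then have inj: "inj ((*v) (transpose R))"
    by (metis invertible_left_inverse matrix_left_invertible_injective)
  have eigval: "nth_gen_eigenvalue (transpose R ** A ** R) (transpose R ** S ** R) = nth_gen_eigenvalue A S"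
    by (simp add: fun_eq_iff nth_gen_eigenvalue_def gen_eigenvalues_congruence[OF R])
  have "(transpose R ** A ** R) *v x = l *\<^sub>R ((transpose R ** S ** R) *v x)
        \<longleftrightarrow> A *v (R *v x) = l *\<^sub>R (S *v (R *v x))" for l x
    using inj_eq[OF inj, of "A *v (R *v x)" "l *\<^sub>R (S *v (R *v x))"]
    by (simp only: matrix_vector_mul_assoc[symmetric] matrix_vector_mult_scaleR)
  moreover have "x \<bullet> ((transpose R ** S ** R) *v y) = (R *v x) \<bullet> (S *v (R *v y))" for x y
    by (simp only: matrix_inner_transpose matrix_vector_mul_assoc[symmetric])
  ultimately show ?thesis unfolding gen_eigen_solution_def eigval by simp
qed

section \<open>The Gaussian mixture model\<close>

text \<open>The between-class part contributes a nonnegative sum of squares. The within-class part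
  is strictly positive, being a nonempty sum of positive terms because
  \<open>K \<ge> 1\<close>.\<close>

lemma sym_pos_def_Sigma_X:
  fixes \<mu> :: "nat \<Rightarrow> real^'p" and C :: "nat \<Rightarrow> real^'p^'p"
  assumes "K \<ge> 1" and pos: "\<And>k. k \<in> {1..K} \<Longrightarrow> \<pi> k > 0"
    and C: "\<And>k. k \<in> {1..K} \<Longrightarrow> sym_pos_def (C k)"
  shows "sym_pos_def (Sigma_X K \<pi> \<mu> C)"
proof -
  have "transpose (Sigma_X K \<pi> \<mu> C) = Sigma_X K \<pi> \<mu> C"
    using C by (simp add: Sigma_X_def Sigma_B_def Sigma_W_def linear_add[OF linear_transpose]
        linear_sum[OF linear_transpose] transpose_scalar sym_pos_def_def)
  moreover have "0 < x \<bullet> (Sigma_X K \<pi> \<mu> C *v x)" if "x \<noteq> 0" for x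
  proof -
    have "x \<bullet> (Sigma_X K \<pi> \<mu> C *v x) =
        (\<Sum>k=1..K. \<pi> k * ((\<mu> k - overall_mean K \<pi> \<mu>) \<bullet> x)\<^sup>2) + (\<Sum>k=1..K. \<pi> k * (x \<bullet> (C k *v x)))"
      by (simp add: Sigma_X_def Sigma_B_def Sigma_W_def matrix_vector_mult_add_rdistrib
          linear_sum[OF linear_matrix_vector_mult_left] scaleR_matrix_vector_assoc[symmetric]
          outer_square_vector_mult inner_add_right inner_sum_right inner_commute[of x "\<mu> _ - _"]
          power2_eq_square mult.assoc)
    moreover have "(\<Sum>k=1..K. \<pi> k * ((\<mu> k - overall_mean K \<pi> \<mu>) \<bullet> x)\<^sup>2) \<ge> 0"
      using pos by (intro sum_nonneg) (simp add: less_imp_le)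
    moreover have "(\<Sum>k=1..K. \<pi> k * (x \<bullet> (C k *v x))) > 0"
      using pos C that \<open>K \<ge> 1\<close> by (intro sum_pos) (auto simp: sym_pos_def_def)
    ultimately show ?thesis by linarith
  qed
  ultimately show ?thesis by (simp add: sym_pos_def_def)
qed

lemma linear_matrix_mult_both: "linear (\<lambda>X :: real^'m^'n. A ** X ** B)"
  by (rule linearI) (simp_all add: matrix_matrix_mult_def vec_eq_iff sum_distrib_left sum_distrib_right
      sum.distrib algebra_simps)

lemma M_SAVE_eq_congruence:
  fixes \<mu> :: "nat \<Rightarrow> real^'p" and C :: "nat \<Rightarrow> real^'p^'p"
  assumes S: "sym_pos_def (Sigma_X K \<pi> \<mu> C)" and sum1: "(\<Sum>k=1..K. \<pi> k) = 1"
    and C: "\<And>k. k \<in> {1..K} \<Longrightarrow> transpose (C k) = C k"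
  shows "M_SAVE K \<pi> \<mu> C = inv_sqrt (Sigma_X K \<pi> \<mu> C) ** M_GMMDRC K \<pi> \<mu> C ** inv_sqrt (Sigma_X K \<pi> \<mu> C)"
proof -
  define S where "S = Sigma_X K \<pi> \<mu> C"
  define B where "B = Sigma_B K \<pi> \<mu>"
  define W where "W = Sigma_W K \<pi> C"
  define R where "R = inv_sqrt S"
  define Q where "Q = matrix_inv S"
  define D where "D k = C k - W" for k
  have S_eq: "S = B + W" by (simp add: S_def B_def W_def Sigma_X_def)
  have RR: "R ** R = Q" and RSR: "R ** S ** R = mat 1"
    using inv_sqrt(2)[OF S] inv_sqrt_congruence[OF S] by (simp_all add: R_def Q_def S_def)
  have "transpose W = W"
    using C by (simp add: W_def Sigma_W_def linear_sum[OF linear_transpose] transpose_scalar)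
  then have D_sym: "transpose (D k) = D k" if "k \<in> {1..K}" for k
    using C[OF that] by (simp add: D_def linear_diff[OF linear_transpose])
  have D_sum: "(\<Sum>k=1..K. \<pi> k *\<^sub>R D k) = 0"
    using sum1 by (simp add: D_def scaleR_diff_right sum_subtractf scaleR_sum_left[symmetric])
      (simp add: W_def Sigma_W_def)
  have summand: "(mat 1 - R ** C k ** R) ** (mat 1 - R ** C k ** R) = R ** ((B - D k) ** Q ** (B - D k)) ** R" for k
  proof -
    have "B - D k = S - C k" by (simp add: S_eq D_def)
    then have "mat 1 - R ** C k ** R = R ** (B - D k) ** R"
      by (simp add: RSR[symmetric] matrix_diff_ldistrib matrix_diff_rdistrib)
    \<comment> \<open>The two inner copies of \<open>R\<close> in the square merge into
      \<open>Q\<close>.\<close>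
    then show ?thesis by (simp add: RR[symmetric] matrix_mul_assoc)
  qed
  have pull_out: "(\<Sum>k=1..K. \<pi> k *\<^sub>R (X ** E k ** Y)) = X ** (\<Sum>k=1..K. \<pi> k *\<^sub>R E k) ** Y"
    for X Y :: "real^'p^'p" and E
    by (simp only: linear_sum[OF linear_matrix_mult_both] linear_scale[OF linear_matrix_mult_both])
  have D_sum': "(\<Sum>k=1..K. \<pi> k *\<^sub>R (X ** D k ** Y)) = 0" for X Y :: "real^'p^'p"
    by (simp only: pull_out D_sum linear_0[OF linear_matrix_mult_both])
  \<comment> \<open>The cross terms are linear in \<open>D k\<close>, so they inherit the vanishing
    weighted sum. Taking \<open>mat 1\<close> as one outer factor fits them to the two-sided form of
    \<open>D_sum'\<close>.\<close>
  have BD: "(\<Sum>k=1..K. \<pi> k *\<^sub>R (B ** Q ** D k)) = 0"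
    using D_sum'[of "B ** Q" "mat 1"] by (simp only: matrix_mul_rid)
  have DB: "(\<Sum>k=1..K. \<pi> k *\<^sub>R (D k ** Q ** B)) = 0"
    using D_sum'[of "mat 1" "Q ** B"] by (simp only: matrix_mul_lid matrix_mul_assoc)
  have "(\<Sum>k=1..K. \<pi> k *\<^sub>R ((B - D k) ** Q ** (B - D k)))
      = (\<Sum>k=1..K. \<pi> k *\<^sub>R (B ** Q ** B)) - (\<Sum>k=1..K. \<pi> k *\<^sub>R (B ** Q ** D k))
        - (\<Sum>k=1..K. \<pi> k *\<^sub>R (D k ** Q ** B)) + (\<Sum>k=1..K. \<pi> k *\<^sub>R (D k ** Q ** D k))"
    unfolding sum_subtractf[symmetric] sum.distrib[symmetric]
    by (intro sum.cong refl) (simp add: matrix_diff_ldistrib matrix_diff_rdistrib algebra_simps)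
  \<comment> \<open>The transpose is inserted by symmetry of \<open>D k\<close> to match the
    summands of \<open>M_II\<close>.\<close>
  also have "\<dots> = B ** Q ** B + (\<Sum>k=1..K. \<pi> k *\<^sub>R (D k ** Q ** transpose (D k)))"
    unfolding BD DB using sum1 D_sym by (simp add: scaleR_sum_left[symmetric])
  also have "\<dots> = M_GMMDRC K \<pi> \<mu> C"
    by (simp add: M_GMMDRC_def M_I_def M_II_def B_def Q_def S_def D_def W_def)
  finally have middle: "(\<Sum>k=1..K. \<pi> k *\<^sub>R ((B - D k) ** Q ** (B - D k))) = M_GMMDRC K \<pi> \<mu> C" .
  have "M_SAVE K \<pi> \<mu> C = (\<Sum>k=1..K. \<pi> k *\<^sub>R (R ** ((B - D k) ** Q ** (B - D k)) ** R))"
    unfolding M_SAVE_def Let_def S_def[symmetric] R_def[symmetric] summand ..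
  also have "\<dots> = R ** (\<Sum>k=1..K. \<pi> k *\<^sub>R ((B - D k) ** Q ** (B - D k))) ** R"
    by (rule pull_out)
  finally show ?thesis unfolding middle by (simp only: R_def S_def)
qed

lemma save_directions_iff_gmmdrc_solution:
  fixes \<mu> :: "nat \<Rightarrow> real^'p" and C :: "nat \<Rightarrow> real^'p^'p"
  assumes S: "sym_pos_def (Sigma_X K \<pi> \<mu> C)" and sum1: "(\<Sum>k=1..K. \<pi> k) = 1"
    and C: "\<And>k. k \<in> {1..K} \<Longrightarrow> transpose (C k) = C k"
  shows "save_directions K \<pi> \<mu> C d \<beta> \<longleftrightarrow> gmmdrc_solution K \<pi> \<mu> C d \<beta>"
proof -
  define S where "S = Sigma_X K \<pi> \<mu> C"
  define R where "R = inv_sqrt S"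
  have tR: "transpose R = R" and R: "invertible R"
    using inv_sqrt(1)[OF S] sym_pos_def_imp_invertible by (auto simp: R_def S_def sym_pos_def_def)
  have SAVE: "M_SAVE K \<pi> \<mu> C = transpose R ** M_GMMDRC K \<pi> \<mu> C ** R"
    using M_SAVE_eq_congruence[OF S sum1 C] unfolding tR by (simp add: R_def S_def)
  have one: "mat 1 = transpose R ** S ** R"
    using inv_sqrt_congruence[OF S] unfolding tR by (simp add: R_def S_def)
  \<comment> \<open>With \<open>mat 1\<close> as the second matrix, the normalization is
    orthonormality and the generalized eigenvalues are the ordinary ones.\<close>
  have "save_directions K \<pi> \<mu> C d \<beta> \<longleftrightarrow>
      (\<exists>v. gen_eigen_solution (M_SAVE K \<pi> \<mu> C) (mat 1) d v \<and> (\<forall>j\<in>{1..d}. \<beta> j = R *v v j))"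
    by (simp add: save_directions_def gen_eigen_solution_def nth_eigenvalue_def R_def S_def conj_assoc)
  also have "\<dots> \<longleftrightarrow> (\<exists>v. gmmdrc_solution K \<pi> \<mu> C d (\<lambda>j. R *v v j) \<and> (\<forall>j\<in>{1..d}. \<beta> j = R *v v j))"
    unfolding SAVE one gen_eigen_solution_congruence[OF R] gmmdrc_solution_def S_def ..
  also have "\<dots> \<longleftrightarrow> gmmdrc_solution K \<pi> \<mu> C d \<beta>"
  proof
    assume "\<exists>v. gmmdrc_solution K \<pi> \<mu> C d (\<lambda>j. R *v v j) \<and> (\<forall>j\<in>{1..d}. \<beta> j = R *v v j)"
    \<comment> \<open>The columns are only known to agree on \<open>{1..d}\<close>, and
      \<open>gen_eigen_solution\<close> inspects no others.\<close>
    then show "gmmdrc_solution K \<pi> \<mu> C d \<beta>"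
      by (auto simp: gmmdrc_solution_def gen_eigen_solution_def)
  next
    assume "gmmdrc_solution K \<pi> \<mu> C d \<beta>"
    moreover have "R *v (matrix_inv R *v \<beta> j) = \<beta> j" for j
      by (simp add: matrix_vector_mul_assoc matrix_inv_mult[OF R])
    ultimately show "\<exists>v. gmmdrc_solution K \<pi> \<mu> C d (\<lambda>j. R *v v j) \<and> (\<forall>j\<in>{1..d}. \<beta> j = R *v v j)"
      by (intro exI[of _ "\<lambda>j. matrix_inv R *v \<beta> j"]) simp
  qed
  finally show ?thesis .
qed

theorem proposition2:
  fixes K d :: nat
    and \<pi> :: "nat \<Rightarrow> real"
    and \<mu> :: "nat \<Rightarrow> real^'p"
    and C :: "nat \<Rightarrow> real^'p^'p"
    and V :: "(real^'p) set"
  assumes "K \<ge> 2"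
    and "d = min CARD('p) (K - 1)"
    and "\<And>k. k \<in> {1..K} \<Longrightarrow> \<pi> k > 0"
    and "(\<Sum>k=1..K. \<pi> k) = 1"
    and "\<And>k. k \<in> {1..K} \<Longrightarrow> sym_pos_def (C k)"
    and "subspace V"
    and "dim V = d"
  shows "(\<exists>\<beta>. gmmdrc_solution K \<pi> \<mu> C d \<beta> \<and> V = column_span d \<beta>) \<longleftrightarrow>
         (\<exists>\<beta>. save_directions K \<pi> \<mu> C d \<beta> \<and> V = column_span d \<beta>)"
proof -
  have "sym_pos_def (Sigma_X K \<pi> \<mu> C)"
    using assms(1,3,5) by (intro sym_pos_def_Sigma_X) auto
  moreover have "transpose (C k) = C k" if "k \<in> {1..K}" for k
    using assms(5)[OF that] by (simp add: sym_pos_def_def)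
  \<comment> \<open>The predicates agree for every \<open>\<beta>\<close>, so the same matrix
    witnesses both sides.\<close>
  ultimately have "save_directions K \<pi> \<mu> C d \<beta> \<longleftrightarrow> gmmdrc_solution K \<pi> \<mu> C d \<beta>" for \<beta>
    using assms(4) by (intro save_directions_iff_gmmdrc_solution)
  then show ?thesis by simp
qed

end
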